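(* Every $2$-step nilpotent finite-dimensional Lie algebra over $\mathbb K=\mathbb R$ or $\mathbb C$ is $T^*$-solitary.
   Context: For a linear map $\phi\colon\mathfrak g\to\mathfrak g^*$: its transpose is ${}^t\phi\colon\mathfrak g\to\mathfrak g^*$, ${}^t\phi(X)(Y)=\phi(Y)(X)$; $\phi$ is symmetric if $\phi={}^t\phi$; $\phi$ is ad-invariant if $\phi([X,Y])(Z)=-\phi(Y)([X,Z])$ for all $X,Y,Z\in\mathfrak g$. A linear map $D\colon\mathfrak g\to\mathfrak g^*$ is a derivation if $D([X,Y])(Z)=D(X)([Y,Z])-D(Y)([X,Z])$ for all $X,Y,Z\in\mathfrak g$. $\mathfrak g$ is $T^*$-solitary if every ad-invariant symmetric linear map $\phi\colon\mathfrak g\to\mathfrak g^*$ can be written as $\phi=D+{}^tD$ for some derivation $D\colon\mathfrak g\to\mathfrak g^*$. *)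

theory Defs
  imports Complex_Main "HOL-Library.Function_Algebras"
begin

locale lie_algebra = vector_space scale
  for scale :: "'k::field \<Rightarrow> 'g::ab_group_add \<Rightarrow> 'g" +
  fixes bracket :: "'g \<Rightarrow> 'g \<Rightarrow> 'g"
  assumes linear_bracket_left: "Vector_Spaces.linear scale scale (\<lambda>X. bracket X Y)"
    and linear_bracket_right: "Vector_Spaces.linear scale scale (\<lambda>Y. bracket X Y)"
    and bracket_self: "bracket X X = 0"
    and jacobi: "bracket X (bracket Y Z) + bracket Y (bracket Z X) + bracket Z (bracket X Y) = 0"
begin

definition finite_dimensional :: bool where
  "finite_dimensional \<longleftrightarrow> (\<exists>Basis. finite_dimensional_vector_space scale Basis)"

primrec lower_central_series :: "nat \<Rightarrow> 'g set" where
  "lower_central_series 0 = UNIV"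
| "lower_central_series (Suc n) = span {bracket X Y | X Y. Y \<in> lower_central_series n}"

text \<open>The nilpotency class is only required to be at most \<open>k\<close>, so that abelian Lie algebras
  count as 2-step nilpotent.\<close>

definition step_nilpotent :: "nat \<Rightarrow> bool" where
  "step_nilpotent k \<longleftrightarrow> lower_central_series k = {0}"

definition dual :: "('g \<Rightarrow> 'k) set" where
  "dual = {f. Vector_Spaces.linear scale (*) f}"

text \<open>Maps from the Lie algebra to its dual are curried functions of type
  \<open>'g \<Rightarrow> 'g \<Rightarrow> 'k\<close> all of whose values lie in \<open>dual\<close>. The dual carries the pointwise
  operations: addition comes from \<open>Function_Algebras\<close>, scaling is given explicitly.\<close>

definition linear_to_dual :: "('g \<Rightarrow> 'g \<Rightarrow> 'k) \<Rightarrow> bool" where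
  "linear_to_dual \<phi> \<longleftrightarrow>
     range \<phi> \<subseteq> dual \<and> Vector_Spaces.linear scale (\<lambda>c f X. c * f X) \<phi>"

definition transpose :: "('g \<Rightarrow> 'g \<Rightarrow> 'k) \<Rightarrow> 'g \<Rightarrow> 'g \<Rightarrow> 'k" where
  "transpose \<phi> X Y = \<phi> Y X"

definition symmetric :: "('g \<Rightarrow> 'g \<Rightarrow> 'k) \<Rightarrow> bool" where
  "symmetric \<phi> \<longleftrightarrow> \<phi> = transpose \<phi>"

definition ad_invariant :: "('g \<Rightarrow> 'g \<Rightarrow> 'k) \<Rightarrow> bool" where
  "ad_invariant \<phi> \<longleftrightarrow> (\<forall>X Y Z. \<phi> (bracket X Y) Z = - \<phi> Y (bracket X Z))"

definition derivation_to_dual :: "('g \<Rightarrow> 'g \<Rightarrow> 'k) \<Rightarrow> bool" where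
  "derivation_to_dual D \<longleftrightarrow> linear_to_dual D \<and>
     (\<forall>X Y Z. D (bracket X Y) Z = D X (bracket Y Z) - D Y (bracket X Z))"

definition T_star_solitary :: bool where
  "T_star_solitary \<longleftrightarrow>
     (\<forall>\<phi>. linear_to_dual \<phi> \<and> symmetric \<phi> \<and> ad_invariant \<phi> \<longrightarrow>
        (\<exists>D. derivation_to_dual D \<and> \<phi> = D + transpose D))"

end

end

theory Submission
  imports Defs
begin

text \<open>Let \<open>p\<close> be a linear projection onto the derived algebra \<open>C\<close>. In the 2-step nilpotent case an
  ad-invariant symmetric \<open>\<phi>\<close> vanishes on \<open>C \<times> C\<close>, and \<open>\<phi>([X,Y], Z) = \<phi>(X, [Y,Z])\<close>. Hence a map \<open>D\<close>
  that equals \<open>a \<phi>\<close> on \<open>C \<times> ker p\<close> and \<open>b \<phi>\<close> on \<open>ker p \<times> C\<close> is a derivation iff \<open>a = 2 b\<close>, while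
  \<open>\<phi> = D + D\<^sup>t\<close> requires \<open>a + b = 1\<close>. This is solved by \<open>a = 2/3\<close>, \<open>b = 1/3\<close>, that is by
  \<open>D(X, Y) = \<phi>(X, Y)/2 + (\<phi>(p X, Y) - \<phi>(X, p Y))/6\<close>.\<close>

context lie_algebra
begin

text \<open>Linearity of \<open>\<phi>\<close> and of each of its values together amount to
  bilinearity; the operations on the dual are pointwise.\<close>

lemma linear_to_dual_iff:
  "linear_to_dual \<phi> \<longleftrightarrow>
     (\<forall>X Y Z. \<phi> (X + Y) Z = \<phi> X Z + \<phi> Y Z) \<and> (\<forall>c X Z. \<phi> (scale c X) Z = c * \<phi> X Z) \<and>
     (\<forall>X Y Z. \<phi> X (Y + Z) = \<phi> X Y + \<phi> X Z) \<and> (\<forall>c X Z. \<phi> X (scale c Z) = c * \<phi> X Z)"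
proof -
  have "vector_space ((*) :: 'k \<Rightarrow> 'k \<Rightarrow> 'k)"
    by unfold_locales (simp_all add: algebra_simps)
  moreover have "vector_space (\<lambda>(c::'k) (f::'g \<Rightarrow> 'k) X. c * f X)"
    by unfold_locales (simp_all add: algebra_simps fun_eq_iff)
  ultimately show ?thesis
    unfolding linear_to_dual_def dual_def Vector_Spaces.linear_iff
    using vector_space_axioms by (auto simp: fun_eq_iff image_subset_iff)
qed

text \<open>Such a \<open>p\<close> is a linear left inverse of the inclusion of \<open>V\<close>,
  chosen with values in \<open>V\<close>.\<close>

lemma exists_linear_projection:
  assumes "subspace V"
  obtains p where "Vector_Spaces.linear scale scale p" "\<And>X. p X \<in> V" "\<And>X. X \<in> V \<Longrightarrow> p X = X"
proof -
  interpret vector_space_pair scale scale ..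
  have "\<exists>p. range p \<subseteq> V \<and> Vector_Spaces.linear scale scale p \<and> (\<forall>X\<in>V. p (id X) = X)"
    by (rule linear_exists_left_inverse_on[OF linear_id assms inj_on_id])
  with that show thesis by auto
qed

lemma bracket_in_lower_central_series:
  "Y \<in> lower_central_series n \<Longrightarrow> bracket X Y \<in> lower_central_series (Suc n)"
  by (auto intro: span_base)

text \<open>The denominators 2 and 6 of \<open>D\<close> make sense once 2 and 3 are invertible,
  which covers the real and the complex case at once.\<close>

lemma two_step_nilpotent_imp_T_star_solitary:
  assumes nil: "step_nilpotent 2" and char: "(2::'k) \<noteq> 0" "(3::'k) \<noteq> 0"
  shows T_star_solitary
  unfolding T_star_solitary_def
proof (intro allI impI)
  fix \<phi> assume "linear_to_dual \<phi> \<and> symmetric \<phi> \<and> ad_invariant \<phi>"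
  then have lin: "linear_to_dual \<phi>" and "symmetric \<phi>" and "ad_invariant \<phi>" by simp_all
  have sym: "\<phi> X Y = \<phi> Y X" for X Y
    using \<open>symmetric \<phi>\<close> unfolding symmetric_def transpose_def by metis
  have inv: "\<phi> (bracket X Y) Z = - \<phi> Y (bracket X Z)" for X Y Z
    using \<open>ad_invariant \<phi>\<close> unfolding ad_invariant_def by blast
  define C where "C = lower_central_series 1"
  have "subspace C" by (simp add: C_def)
  then obtain p where p: "Vector_Spaces.linear scale scale p" "\<And>X. p X \<in> C" "\<And>X. X \<in> C \<Longrightarrow> p X = X"
    using exists_linear_projection by blast
  have bracket_C: "bracket X Y \<in> C" for X Y
    using bracket_in_lower_central_series[of Y 0] by (simp add: C_def)
  \<comment> \<open>The series starts at index 0 with the whole algebra, so a bracket with an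
    element of \<open>C\<close> lies in the term of index 2, which is zero.\<close>
  have bracket_central: "bracket X Y = 0" if "Y \<in> C" for X Y
    using bracket_in_lower_central_series[of Y 1 X] that nil
    by (simp only: C_def step_nilpotent_def One_nat_def numeral_2_eq_2 singleton_iff)
  have bilin: "\<phi> (X + Y) Z = \<phi> X Z + \<phi> Y Z" "\<phi> (scale c X) Z = c * \<phi> X Z"
    "\<phi> X (Y + Z) = \<phi> X Y + \<phi> X Z" "\<phi> X (scale c Y) = c * \<phi> X Y" for X Y Z c
    using lin by (simp_all add: linear_to_dual_iff)
  have zero_right: "\<phi> X 0 = 0" for X using bilin(4)[of X 0 0] by simp
  \<comment> \<open>Invariance moves \<open>X\<close> onto the central element \<open>Z\<close>;
    symmetry gives the second form.\<close>
  have vanish: "\<phi> (bracket X Y) Z = 0" "\<phi> Z (bracket X Y) = 0" if "Z \<in> C" for X Y Z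
    using inv[of X Y Z] bracket_central[OF that] zero_right sym[of Z] by simp_all
  \<comment> \<open>Invariance yields \<open>- \<phi> (bracket Y X) Z\<close>; antisymmetry,
    obtained by polarising \<open>bracket_self\<close>, removes the sign.\<close>
  have cyc: "\<phi> X (bracket Y Z) = \<phi> (bracket X Y) Z" for X Y Z
  proof -
    have "bracket (X + Y) (X + Y) = bracket X Y + bracket Y X"
      using linear_bracket_left linear_bracket_right
      by (simp only: Vector_Spaces.linear_iff) (simp add: bracket_self[of X] bracket_self[of Y])
    then have "bracket X Y + bracket Y X = 0" by (simp add: bracket_self)
    then have "\<phi> (bracket X Y) Z + \<phi> (bracket Y X) Z = 0"
      by (metis bilin(1) sym zero_right)
    with inv[of Y X Z] show ?thesis by (metis add.commute add_eq_0_iff minus_minus)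
  qed
  define D where "D X Y = \<phi> X Y / 2 + (\<phi> (p X) Y - \<phi> X (p Y)) / 6" for X Y
  have half: "t / 2 = t / 6 + t / 6 + t / 6" for t :: 'k
  proof -
    have "(6::'k) = 2 * 3" by simp
    then have "t / 6 = t / 2 / 3" by (simp only: divide_divide_eq_left)
    moreover have "s = s / 3 + s / 3 + s / 3" for s :: 'k
      using char by (simp add: field_simps)
    ultimately show ?thesis by metis
  qed
  have double_half: "t = t / 2 + t / 2" for t :: 'k
    using char by (simp add: field_simps)
  have "linear_to_dual D"
    using p(1) unfolding linear_to_dual_iff
    by (auto simp: D_def Vector_Spaces.linear_iff bilin add_divide_distrib diff_divide_distrib algebra_simps)
  moreover have "D (bracket X Y) Z = D X (bracket Y Z) - D Y (bracket X Z)" for X Y Z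
  proof -
    \<comment> \<open>\<open>p\<close> fixes brackets, and the term pairing a bracket with a value
      of \<open>p\<close> vanishes. The coefficients are thus 1/2 + 1/6 = 2/3 on the left and 1/2 -
      1/6 = 1/3 in each term on the right.\<close>
    have "D (bracket X Y) Z = \<phi> (bracket X Y) Z / 2 + \<phi> (bracket X Y) Z / 6"
      by (simp add: D_def p bracket_C vanish)
    moreover have "D X (bracket Y Z) = \<phi> (bracket X Y) Z / 2 - \<phi> (bracket X Y) Z / 6"
      by (simp add: D_def p bracket_C vanish cyc[symmetric])
    moreover have "D Y (bracket X Z) = - (\<phi> (bracket X Y) Z / 2 - \<phi> (bracket X Y) Z / 6)"
      using inv[of X Y Z] by (simp add: D_def p bracket_C vanish)
    moreover have "t / 2 + t / 6 = (t / 2 - t / 6) - - (t / 2 - t / 6)" for t :: 'k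
      by (simp add: half)
    ultimately show ?thesis by simp
  qed
  \<comment> \<open>The correction with factor 1/6 is antisymmetric in \<open>X\<close> and
    \<open>Y\<close>, so it cancels against its transpose.\<close>
  moreover have "\<phi> = D + transpose D"
  proof (intro ext)
    fix X Y
    show "\<phi> X Y = (D + transpose D) X Y"
      using double_half[of "\<phi> X Y"]
      by (simp add: D_def transpose_def sym[of Y] sym[of "p Y"] diff_divide_distrib)
  qed
  ultimately show "\<exists>D. derivation_to_dual D \<and> \<phi> = D + transpose D"
    unfolding derivation_to_dual_def by blast
qed

end

theorem corollary5p14:
  "(\<forall>(scale :: real \<Rightarrow> 'g::ab_group_add \<Rightarrow> 'g) bracket.
      lie_algebra scale bracket \<and> lie_algebra.finite_dimensional scale \<and>
      lie_algebra.step_nilpotent scale bracket 2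
      \<longrightarrow> lie_algebra.T_star_solitary scale bracket) \<and>
   (\<forall>(scale :: complex \<Rightarrow> 'h::ab_group_add \<Rightarrow> 'h) bracket.
      lie_algebra scale bracket \<and> lie_algebra.finite_dimensional scale \<and>
      lie_algebra.step_nilpotent scale bracket 2
      \<longrightarrow> lie_algebra.T_star_solitary scale bracket)"
  by (auto intro: lie_algebra.two_step_nilpotent_imp_T_star_solitary)

end
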